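(* Let $q>2$, $t\ge 1$, $k$, $n$ and $\epsilon$ be integers with $0\le\epsilon\le k-t-1$ and $n\ge 2k-t-\epsilon$. Then the anticodes $\mathcal A_q(t,\epsilon,k,n)$ and $\mathcal A_q(t-1,\epsilon+2,k,n)$ both have diameter $2k-2t-\epsilon$, and $$|\mathcal A_q(t-1,\epsilon+2,k,n)|>|\mathcal A_q(t,\epsilon,k,n)|$$ if and only if $q>\frac{n+k-2t-2\epsilon}{k-t-\epsilon}$, or equivalently if and only if $n<(q-2)(k-t-\epsilon)+k$.
   Context: $\mathbb Z_q=\{0,1,\dots,q-1\}$ is the alphabet. The weight $\mathrm{wt}(x)$ of a word $x$ over $\mathbb Z_q$ is the number of its nonzero entries. The diameter of a set of words of length $n$ is the maximum Hamming distance (number of differing coordinates) between two of its words. For integers $s\ge 0$ and $0\le\delta\le k-s$, $\mathcal A_q(s,\delta,k,n)$ is the set of all words of length $n$ over $\mathbb Z_q$ of the form $(1,\dots,1,a_1,\dots,a_\delta,b_1,\dots,b_{n-s-\delta})$, starting with $s$ ones, where $a_i\in\mathbb Z_q\setminus\{0\}$, $b_i\in\mathbb Z_q$ and $\mathrm{wt}(b_1,\dots,b_{n-s-\delta})=k-s-\delta$. *)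

theory Defs
  imports Complex_Main
begin

text \<open>Words over $\mathbb{Z}_q = \{0,\dots,q-1\}$ are lists of natural numbers less than \<open>q\<close>.\<close>

definition words :: "nat \<Rightarrow> nat \<Rightarrow> nat list set" where
  "words q n = {w. length w = n \<and> set w \<subseteq> {0..<q}}"

definition wt :: "nat list \<Rightarrow> nat" where
  "wt x = card {i. i < length x \<and> x ! i \<noteq> 0}"

text \<open>Only meant for words of equal length.\<close>

definition hamming_dist :: "nat list \<Rightarrow> nat list \<Rightarrow> nat" where
  "hamming_dist x y = card {i. i < length x \<and> x ! i \<noteq> y ! i}"

text \<open>Only meant for nonempty finite sets of words of equal length, since \<open>Max\<close> is
  unspecified on empty and infinite sets.\<close>

definition hamming_diameter :: "nat list set \<Rightarrow> nat" where
  "hamming_diameter S = Max {hamming_dist x y | x y. x \<in> S \<and> y \<in> S}"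

text \<open>The conditions $|b| = n-s-\delta$ and $\mathrm{wt}(b) = k-s-\delta$ are written
  additively, to avoid truncated subtraction on natural numbers.\<close>

definition anticode :: "nat \<Rightarrow> nat \<Rightarrow> nat \<Rightarrow> nat \<Rightarrow> nat \<Rightarrow> nat list set" where
  "anticode q s \<delta> k n =
     {w \<in> words q n. \<exists>a b. w = replicate s 1 @ a @ b \<and>
        length a = \<delta> \<and> set a \<subseteq> {0..<q} - {0} \<and>
        s + \<delta> + length b = n \<and> set b \<subseteq> {0..<q} \<and> s + \<delta> + wt b = k}"

end

theory Submission
  imports Defs
begin

text \<open>
  Both anticodes are, up to a constant prefix of ones, products of a cube
  \<open>{1,\<dots>,q-1}\<^sup>\<delta>\<close> and a sphere of weight \<open>w = k - s - \<delta>\<close> in a space of dimension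
  \<open>m = n - s - \<delta>\<close>.

  Diameter: the free block contributes at most \<open>\<delta>\<close> to a distance, and two words of weight \<open>w\<close>
  differ at most on the union of their supports, that is in \<open>2 * w\<close> places.  Both bounds are
  attained: the free blocks can be all-one and all-two because \<open>q > 2\<close>, and two disjoint supports
  exist because \<open>2 * w \<le> m\<close>.  Passing from \<open>(s, \<delta>)\<close> to \<open>(s - 1, \<delta> + 2)\<close> lowers \<open>w\<close> by one
  and so leaves \<open>\<delta> + 2 * w\<close> unchanged.

  Size: choosing the support and then the nonzero letters gives
  \<open>(m choose w) * (q - 1) ^ (\<delta> + w)\<close> words.  Put \<open>N = n - t - \<epsilon>\<close> and \<open>K = k - t - \<epsilon>\<close>.  After
  cancelling \<open>(q - 1) ^ (\<epsilon> + K)\<close> the comparison of the two sizes reads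
  \<open>N choose K < (q - 1) * ((N - 1) choose (K - 1))\<close>, and the absorption identity
  \<open>K * (N choose K) = N * ((N - 1) choose (K - 1))\<close> turns it into \<open>N < (q - 1) * K\<close>.  The two
  conditions on \<open>q\<close> and \<open>n\<close> are rearrangements of this inequality.
\<close>

section \<open>Weight and Hamming distance\<close>

lemma wt_Nil [simp]: "wt [] = 0"
  by (simp add: wt_def)

lemma wt_eq_length_filter: "wt x = length (filter (\<lambda>a. a \<noteq> 0) x)"
  by (simp add: wt_def length_filter_conv_card)

lemma wt_Cons [simp]: "wt (a # x) = (if a = 0 then wt x else Suc (wt x))"
  by (simp add: wt_eq_length_filter)

lemma wt_append [simp]: "wt (x @ y) = wt x + wt y"
  by (simp add: wt_eq_length_filter)

lemma wt_replicate [simp]: "wt (replicate m a) = (if a = 0 then 0 else m)"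
  by (induction m) auto

lemma hamming_dist_eq_length_filter:
  assumes "length x = length y"
  shows "hamming_dist x y = length (filter (\<lambda>(a, b). a \<noteq> b) (zip x y))"
  unfolding hamming_dist_def length_filter_conv_card
  using assms by (intro arg_cong[where f = card]) auto

lemma hamming_dist_append:
  assumes "length x = length x'" "length y = length y'"
  shows "hamming_dist (x @ y) (x' @ y') = hamming_dist x x' + hamming_dist y y'"
  using assms by (simp add: hamming_dist_eq_length_filter)

lemma hamming_dist_replicate [simp]:
  "hamming_dist (replicate m a) (replicate m b) = (if a = b then 0 else m)"
  by (simp add: hamming_dist_eq_length_filter zip_replicate)

lemma hamming_dist_le_length:
  assumes "length x = length y"
  shows "hamming_dist x y \<le> length x"
  using length_filter_le[of _ "zip x y"] assms by (simp add: hamming_dist_eq_length_filter)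

text \<open>Two words can only differ on the union of their supports.\<close>

lemma hamming_dist_le_wt:
  assumes "length x = length y"
  shows "hamming_dist x y \<le> wt x + wt y"
proof -
  have "hamming_dist x y
      \<le> card ({i. i < length x \<and> x ! i \<noteq> 0} \<union> {i. i < length y \<and> y ! i \<noteq> 0})"
    unfolding hamming_dist_def using assms by (intro card_mono) auto
  also have "\<dots> \<le> wt x + wt y"
    unfolding wt_def by (rule card_Un_le)
  finally show ?thesis .
qed

section \<open>Spheres and the size of an anticode\<close>

definition sphere :: "nat \<Rightarrow> nat \<Rightarrow> nat \<Rightarrow> nat list set" where
  "sphere q m w = {b. length b = m \<and> set b \<subseteq> {0..<q} \<and> wt b = w}"

lemma finite_sphere [simp]: "finite (sphere q m w)"
  by (rule finite_subset[OF _ finite_lists_length_eq[of "{0..<q}" m]]) (auto simp: sphere_def)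

text \<open>Splitting off the first letter, zero or not, is Pascal's rule; the \<open>q - 1\<close> nonzero
  letters account for the power.\<close>

lemma card_sphere:
  assumes "q > 0"
  shows "card (sphere q m w) = (m choose w) * (q - 1) ^ w"
proof (induction m arbitrary: w)
  case 0
  have "sphere q 0 w = (if w = 0 then {[]} else {})"
    by (auto simp: sphere_def)
  then show ?case by simp
next
  case (Suc m)
  have inj0: "inj_on ((#) 0) (sphere q m w)" for w
    by (auto intro: inj_onI)
  show ?case
  proof (cases w)
    case 0
    have "sphere q (Suc m) 0 = (#) 0 ` sphere q m 0"
      using assms by (auto simp: sphere_def length_Suc_conv split: if_splits)
    then show ?thesis using Suc[of 0] inj0 0 by (simp add: card_image)
  next
    case (Suc v)
    define Z where "Z = (#) 0 ` sphere q m w"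
    define Y where "Y = (\<lambda>(c, b). c # b) ` ({1..<q} \<times> sphere q m v)"
    have split: "sphere q (Suc m) w = Z \<union> Y"
      using assms Suc
      by (auto simp: sphere_def Z_def Y_def length_Suc_conv image_iff split: if_splits)
    have "Z \<inter> Y = {}" by (auto simp: Z_def Y_def)
    then have "card (sphere q (Suc m) w) = card Z + card Y"
      unfolding split by (intro card_Un_disjoint) (auto simp: Z_def Y_def)
    also have "card Z = (m choose w) * (q - 1) ^ w"
      using inj0 by (simp add: Z_def card_image Suc.IH)
    also have "card Y = (q - 1) * ((m choose v) * (q - 1) ^ v)"
      unfolding Y_def by (subst card_image) (auto intro: inj_onI simp: card_cartesian_product Suc.IH)
    finally show ?thesis by (simp add: Suc distrib_right distrib_left ac_simps)
  qed
qed

text \<open>An anticode word is determined by its free block and its tail, which can be chosen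
  independently.  The alphabet has to contain the letter \<open>1\<close> of the prefix, whence \<open>q > 1\<close>.\<close>

lemma anticode_eq_image:
  assumes "q > 1" "s + \<delta> \<le> k" "s + \<delta> \<le> n"
  shows "anticode q s \<delta> k n = (\<lambda>(a, b). replicate s 1 @ a @ b) `
    ({a. set a \<subseteq> {0..<q} - {0} \<and> length a = \<delta>} \<times> sphere q (n - s - \<delta>) (k - s - \<delta>))"
  (is "?A = ?f ` (?C \<times> ?S)")
proof (intro set_eqI iffI)
  fix w assume "w \<in> ?A"
  then obtain a b where w: "w = replicate s 1 @ a @ b" and "a \<in> ?C" "b \<in> ?S"
    unfolding anticode_def sphere_def by auto
  then show "w \<in> ?f ` (?C \<times> ?S)" by auto
next
  fix w assume "w \<in> ?f ` (?C \<times> ?S)"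
  then obtain a b where w: "w = replicate s 1 @ a @ b" "a \<in> ?C" "b \<in> ?S" by auto
  then have "w \<in> words q n" using assms by (auto simp: words_def sphere_def)
  moreover have "length a = \<delta>" "set a \<subseteq> {0..<q} - {0}" "s + \<delta> + length b = n"
    "set b \<subseteq> {0..<q}" "s + \<delta> + wt b = k"
    using w assms by (auto simp: sphere_def)
  ultimately show "w \<in> ?A" using w(1) unfolding anticode_def by blast
qed

lemma card_anticode:
  assumes "q > 1" "s + \<delta> \<le> k" "s + \<delta> \<le> n"
  shows "card (anticode q s \<delta> k n) = ((n - s - \<delta>) choose (k - s - \<delta>)) * (q - 1) ^ (k - s)"
proof -
  let ?C = "{a. set a \<subseteq> {0..<q} - {0} \<and> length a = \<delta>}"
  let ?S = "sphere q (n - s - \<delta>) (k - s - \<delta>)"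
  have "card ?C = (q - 1) ^ \<delta>"
    using assms by (subst card_lists_length_eq) auto
  moreover have "inj_on (\<lambda>(a, b). replicate s 1 @ a @ b) (?C \<times> ?S)"
  proof (rule inj_onI)
    fix u v
    assume "u \<in> ?C \<times> ?S" "v \<in> ?C \<times> ?S"
    then have "length (fst u) = length (fst v)"
      by force
    moreover assume "(\<lambda>(a, b). replicate s 1 @ a @ b) u = (\<lambda>(a, b). replicate s 1 @ a @ b) v"
    ultimately show "u = v"
      by (simp add: case_prod_beta prod_eq_iff)
  qed
  then have "card (anticode q s \<delta> k n) = card (?C \<times> ?S)"
    unfolding anticode_eq_image[OF assms] by (rule card_image)
  ultimately have "card (anticode q s \<delta> k n)
      = (q - 1) ^ \<delta> * (((n - s - \<delta>) choose (k - s - \<delta>)) * (q - 1) ^ (k - s - \<delta>))"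
    using assms(1) by (simp only: card_cartesian_product card_sphere)
  also have "\<dots> = ((n - s - \<delta>) choose (k - s - \<delta>)) * (q - 1) ^ (\<delta> + (k - s - \<delta>))"
    by (simp only: power_add ac_simps)
  also have "\<delta> + (k - s - \<delta>) = k - s"
    using assms(2) by simp
  finally show ?thesis .
qed

section \<open>The diameter of an anticode\<close>

lemma finite_words [simp]: "finite (words q n)"
  by (rule finite_subset[OF _ finite_lists_length_eq[of "{0..<q}" n]]) (auto simp: words_def)

lemma hamming_diameter_eqI:
  assumes "finite S"
    and "\<And>x y. x \<in> S \<Longrightarrow> y \<in> S \<Longrightarrow> hamming_dist x y \<le> d"
    and "x \<in> S" "y \<in> S" "hamming_dist x y = d"
  shows "hamming_diameter S = d"
  unfolding hamming_diameter_def
proof (rule Max_eqI)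
  have "{hamming_dist x y |x y. x \<in> S \<and> y \<in> S} = (\<lambda>(x, y). hamming_dist x y) ` (S \<times> S)"
    by auto
  then show "finite {hamming_dist x y |x y. x \<in> S \<and> y \<in> S}" using assms(1) by simp
qed (use assms in auto)

lemma hamming_dist_anticode_le:
  assumes "x \<in> anticode q s \<delta> k n" "y \<in> anticode q s \<delta> k n"
  shows "hamming_dist x y \<le> \<delta> + 2 * (k - s - \<delta>)"
proof -
  obtain a b where x: "x = replicate s 1 @ a @ b" "length a = \<delta>"
    "s + \<delta> + length b = n" "s + \<delta> + wt b = k"
    using assms(1) by (auto simp: anticode_def)
  obtain a' b' where y: "y = replicate s 1 @ a' @ b'" "length a' = \<delta>"
    "s + \<delta> + length b' = n" "s + \<delta> + wt b' = k"
    using assms(2) by (auto simp: anticode_def)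
  have "hamming_dist x y = hamming_dist a a' + hamming_dist b b'"
    using x y by (simp add: hamming_dist_append)
  moreover have "hamming_dist a a' \<le> \<delta>" using hamming_dist_le_length x y by metis
  moreover have "hamming_dist b b' \<le> wt b + wt b'" using x y by (intro hamming_dist_le_wt) simp
  ultimately show ?thesis using x y by linarith
qed

lemma hamming_diameter_anticode:
  assumes "q > 2" "s + \<delta> \<le> k" "2 * k \<le> n + s + \<delta>"
  shows "hamming_diameter (anticode q s \<delta> k n) = \<delta> + 2 * (k - s - \<delta>)"
proof -
  define w where "w = k - s - \<delta>"
  define r where "r = n - s - \<delta> - 2 * w"
  have n: "n = s + \<delta> + (w + (w + r))" and k: "k = s + \<delta> + w"
    using assms by (auto simp: w_def r_def)
  \<comment> \<open>tails of weight \<open>w\<close> with disjoint supports; \<open>r\<close> is the room left beside them\<close>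
  define b where "b = replicate w (1 :: nat) @ replicate w 0 @ replicate r 0"
  define b' where "b' = replicate w (0 :: nat) @ replicate w 1 @ replicate r 0"
  define x where "x = replicate s 1 @ replicate \<delta> 1 @ b"
  define y where "y = replicate s 1 @ replicate \<delta> 2 @ b'"
  have lists: "b \<in> sphere q (n - s - \<delta>) (k - s - \<delta>)" "b' \<in> sphere q (n - s - \<delta>) (k - s - \<delta>)"
    using assms(1) by (auto simp: sphere_def b_def b'_def n k)
  have "x \<in> anticode q s \<delta> k n" "y \<in> anticode q s \<delta> k n"
    using assms(1,2) lists n unfolding x_def y_def
    by (subst anticode_eq_image, auto)+
  moreover have "hamming_dist x y = \<delta> + 2 * (k - s - \<delta>)"
    unfolding x_def y_def b_def b'_def by (simp add: hamming_dist_append k)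
  moreover have "finite (anticode q s \<delta> k n)"
    by (rule finite_subset[OF _ finite_words[of q n]]) (auto simp: anticode_def)
  ultimately show ?thesis
    by (intro hamming_diameter_eqI hamming_dist_anticode_le)
qed

section \<open>Comparing the two sizes\<close>

text \<open>Multiplying by \<open>K\<close> lets the absorption identity expose a common positive factor.\<close>

lemma choose_less_mult_choose_iff:
  fixes c N K :: nat
  assumes "0 < K" "K \<le> N"
  shows "N choose K < c * ((N - 1) choose (K - 1)) \<longleftrightarrow> N < c * K"
proof -
  have absorb: "K * (N choose K) = N * ((N - 1) choose (K - 1))"
    using assms times_binomial_minus1_eq by blast
  have pos: "0 < (N - 1) choose (K - 1)" using assms by (simp add: zero_less_binomial_iff)
  have "N choose K < c * ((N - 1) choose (K - 1))
      \<longleftrightarrow> K * (N choose K) < K * (c * ((N - 1) choose (K - 1)))"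
    using assms by simp
  also have "\<dots> \<longleftrightarrow> N * ((N - 1) choose (K - 1)) < (c * K) * ((N - 1) choose (K - 1))"
    unfolding absorb by (simp add: ac_simps)
  also have "\<dots> \<longleftrightarrow> N < c * K" using pos by simp
  finally show ?thesis .
qed

text \<open>Trading one prefix letter for two free ones gains a net factor \<open>q - 1\<close> and turns the coefficient
  \<open>N choose K\<close> into \<open>(N - 1) choose (K - 1)\<close>.\<close>

lemma card_anticode_less_iff:
  assumes "q > 1" "t \<ge> 1" "t + \<epsilon> < k" "k \<le> n"
  shows "card (anticode q t \<epsilon> k n) < card (anticode q (t - 1) (\<epsilon> + 2) k n)
    \<longleftrightarrow> n - t - \<epsilon> < (q - 1) * (k - t - \<epsilon>)"
proof -
  define N where "N = n - t - \<epsilon>"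
  define K where "K = k - t - \<epsilon>"
  have "card (anticode q t \<epsilon> k n) = (N choose K) * (q - 1) ^ (k - t)"
    using assms by (simp add: card_anticode N_def K_def)
  moreover have "card (anticode q (t - 1) (\<epsilon> + 2) k n)
      = ((N - 1) choose (K - 1)) * (q - 1) ^ Suc (k - t)"
  proof -
    have "n - (t - 1) - (\<epsilon> + 2) = N - 1" "k - (t - 1) - (\<epsilon> + 2) = K - 1" "k - (t - 1) = Suc (k - t)"
      using assms by (auto simp: N_def K_def)
    then show ?thesis using assms by (subst card_anticode) auto
  qed
  ultimately have "card (anticode q t \<epsilon> k n) < card (anticode q (t - 1) (\<epsilon> + 2) k n)
      \<longleftrightarrow> (N choose K) * (q - 1) ^ (k - t)
          < ((q - 1) * ((N - 1) choose (K - 1))) * (q - 1) ^ (k - t)"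
    by (simp add: ac_simps)
  also have "\<dots> \<longleftrightarrow> N choose K < (q - 1) * ((N - 1) choose (K - 1))"
    using assms by simp
  also have "\<dots> \<longleftrightarrow> N < (q - 1) * K"
    using assms by (intro choose_less_mult_choose_iff) (auto simp: N_def K_def)
  finally show ?thesis by (simp add: N_def K_def)
qed

theorem lemma6:
  fixes q t k n \<epsilon> :: nat
  assumes "q > 2" and "t \<ge> 1"
    and "int \<epsilon> \<le> int k - int t - 1"
    and "int n \<ge> 2 * int k - int t - int \<epsilon>"
  shows "int (hamming_diameter (anticode q t \<epsilon> k n)) = 2 * int k - 2 * int t - int \<epsilon>
    \<and> int (hamming_diameter (anticode q (t - 1) (\<epsilon> + 2) k n)) = 2 * int k - 2 * int t - int \<epsilon>
    \<and> (card (anticode q (t - 1) (\<epsilon> + 2) k n) > card (anticode q t \<epsilon> k n)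
         \<longleftrightarrow> real q > (real n + real k - 2 * real t - 2 * real \<epsilon>) / (real k - real t - real \<epsilon>))
    \<and> (card (anticode q (t - 1) (\<epsilon> + 2) k n) > card (anticode q t \<epsilon> k n)
         \<longleftrightarrow> int n < (int q - 2) * (int k - int t - int \<epsilon>) + int k)"
proof -
  have te: "t + \<epsilon> < k" and n: "2 * k \<le> n + t + \<epsilon>" and kn: "k \<le> n"
    using assms(3,4) by linarith+
  have "hamming_diameter (anticode q t \<epsilon> k n) = \<epsilon> + 2 * (k - t - \<epsilon>)"
    using assms(1) te n by (intro hamming_diameter_anticode) linarith+
  then have diam1: "int (hamming_diameter (anticode q t \<epsilon> k n)) = 2 * int k - 2 * int t - int \<epsilon>"
    using te by linarith
  have "hamming_diameter (anticode q (t - 1) (\<epsilon> + 2) k n)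
      = \<epsilon> + 2 + 2 * (k - (t - 1) - (\<epsilon> + 2))"
    using assms(1,2) te n by (intro hamming_diameter_anticode) linarith+
  then have diam2: "int (hamming_diameter (anticode q (t - 1) (\<epsilon> + 2) k n))
      = 2 * int k - 2 * int t - int \<epsilon>"
    using assms(2) te by linarith
  define K where "K = k - t - \<epsilon>"
  define N where "N = n - t - \<epsilon>"
  have k_eq: "k = t + \<epsilon> + K" and n_eq: "n = t + \<epsilon> + N" and K: "K > 0"
    using te kn by (auto simp: K_def N_def)
  have less: "card (anticode q (t - 1) (\<epsilon> + 2) k n) > card (anticode q t \<epsilon> k n)
      \<longleftrightarrow> int N < (int q - 1) * int K"
  proof -
    have "card (anticode q (t - 1) (\<epsilon> + 2) k n) > card (anticode q t \<epsilon> k n)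
        \<longleftrightarrow> N < (q - 1) * K"
      using card_anticode_less_iff assms(1,2) te kn unfolding N_def K_def by simp
    also have "\<dots> \<longleftrightarrow> int N < int ((q - 1) * K)"
      by (simp only: of_nat_less_iff)
    also have "int ((q - 1) * K) = (int q - 1) * int K"
      using assms(1) by (simp add: of_nat_diff)
    finally show ?thesis .
  qed
  have crit_q: "int N < (int q - 1) * int K
      \<longleftrightarrow> real q > (real n + real k - 2 * real t - 2 * real \<epsilon>) / (real k - real t - real \<epsilon>)"
  proof -
    have "int N < (int q - 1) * int K
        \<longleftrightarrow> real_of_int (int N) < real_of_int ((int q - 1) * int K)"
      by (simp only: of_int_less_iff)
    also have "\<dots> \<longleftrightarrow> real q > (real N + real K) / real K"
      using K by (simp add: field_simps)
    also have "(real N + real K) / real K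
        = (real n + real k - 2 * real t - 2 * real \<epsilon>) / (real k - real t - real \<epsilon>)"
      by (simp add: k_eq n_eq)
    finally show ?thesis .
  qed
  have crit_n: "int N < (int q - 1) * int K
      \<longleftrightarrow> int n < (int q - 2) * (int k - int t - int \<epsilon>) + int k"
    by (simp add: k_eq n_eq algebra_simps)
  show ?thesis
    by (intro conjI diam1 diam2 trans[OF less crit_q] trans[OF less crit_n])
qed

end
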